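(* Let $E$ be a semilattice with zero, let $B$ be a generalized Boolean algebra, and let $\pi:E\to B$ be a representation of $E$ in $B$. Then: (i) if $\pi$ is tight then it is also cover-to-join; (ii) if $\pi$ is cover-to-join then there exists an ideal $B'$ of $B$, containing the range of $\pi$, such that, once $\pi$ is seen as a representation of $E$ in $B'$, one has that $\pi$ is tight.
   Context: A semilattice here is a meet-semilattice, i.e. a commutative idempotent semigroup with operation $\wedge$, ordered by $x\leq y \Leftrightarrow x\wedge y=x$; all semilattices have a zero element $0$. We write $x\perp y$ when $x\wedge y=0$. A generalized Boolean algebra is a set $B$ with binary operations $\wedge,\vee$ and an element $0$ such that for all $a,b,c\in B$: $\wedge$ and $\vee$ are commutative; $(a\wedge b)\wedge c=a\wedge(b\wedge c)$; $a\wedge(b\vee c)=(a\wedge b)\vee(a\wedge c)$; $a\vee 0=a$; if $a=a\wedge b$ (written $a\leq b$) there is $x\in B$ with $x\vee a=b$ and $x\wedge a=0$ (the relative complement, denoted $b\setminus a$); and $a\vee a=a=a\wedge a$. It is a Boolean algebra if there is $1\in B$ with $a\wedge 1=a$ for all $a\in B$; then $\neg a:=1\setminus a$. An ideal of $B$ is a nonempty subset $C$ closed under $\vee$ such that $a\leq b\in C$ implies $a\in C$; an ideal is itself a generalized Boolean algebra with the restricted operations (it may have a unit different from any unit of $B$). A representation of $E$ in a generalized Boolean algebra $B$ is a map $\pi:E\to B$ with $\pi(0)=0$ and $\pi(x\wedge y)=\pi(x)\wedge\pi(y)$ for all $x,y\in E$. If $F\subseteq E$, a subset $Z\subseteq F$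 is a cover for $F$ if for every nonzero $x\in F$ there is $z\in Z$ with $z\wedge x\neq 0$. "$E$ admits a finite cover" means that there is a finite cover for $F=E$. For finite subsets $X,Y\subseteq E$ put $$E^{X,Y}=\{z\in E: z\leq x\ \forall x\in X,\ \text{and } z\perp y\ \forall y\in Y\}.$$ Consider the condition $$( * )\qquad \bigvee_{z\in Z}\pi(z)=\bigwedge_{x\in X}\pi(x)\wedge\bigwedge_{y\in Y}\neg\pi(y),$$ where empty joins are $0$ and empty meets are $1$. Tight: a representation $\pi$ of $E$ in a generalized Boolean algebra $B$ is tight if either (a) $B$ is a Boolean algebra and $( * )$ holds for all finite subsets $X,Y\subseteq E$ and every finite cover $Z$ for $E^{X,Y}$; or (b) $E$ admits no finite cover and $( * )$ holds for all finite subsets $X,Y\subseteq E$ and every finite cover $Z$ for $E^{X,Y}$. In case (b) $X$ is necessarily nonempty whenever such a $Z$ exists (if $X=\emptyset$ then $Z\cup Y$ would be a finite cover for $E$), and the right-hand side of $( * )$ is interpreted in $B$ by means of relative complements, as $\big(\bigwedge_{x\in X}\pi(x)\big)\setminus\big(\bigwedge_{x\in X}\pi(x)\wedge\bigvee_{y\in Y}\pi(y)\big)$. Cover-to-join: $\pi$ is cover-to-join if for every $x\in E$ and every finite cover $Z$ for $\{z\in E: z\leq x\}$ one has $\bigvee_{z\in Z}\pi(z)=\pi(x)$. *)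

theory Defs
  imports "HOL-Algebra.FiniteProduct"
begin

section \<open>Generalized Boolean algebras\<close>

record 'b gen_boolean = "'b partial_object" +
  gmeet :: "'b \<Rightarrow> 'b \<Rightarrow> 'b"  (infixl "\<^bold>\<and>\<index>" 70)
  gjoin :: "'b \<Rightarrow> 'b \<Rightarrow> 'b"  (infixl "\<^bold>\<or>\<index>" 65)
  gzero :: 'b  ("\<^bold>0\<index>")

definition gle :: "('b, 'm) gen_boolean_scheme \<Rightarrow> 'b \<Rightarrow> 'b \<Rightarrow> bool"  (infix "\<preceq>\<index>" 50) where
  "a \<preceq>\<^bsub>B\<^esub> b \<longleftrightarrow> a = a \<^bold>\<and>\<^bsub>B\<^esub> b"

locale generalized_boolean_algebra =
  fixes B :: "('b, 'm) gen_boolean_scheme" (structure)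
  assumes zero_closed [simp, intro]: "\<^bold>0 \<in> carrier B"
    and meet_closed [simp, intro]:
      "\<lbrakk>a \<in> carrier B; b \<in> carrier B\<rbrakk> \<Longrightarrow> a \<^bold>\<and> b \<in> carrier B"
    and join_closed [simp, intro]:
      "\<lbrakk>a \<in> carrier B; b \<in> carrier B\<rbrakk> \<Longrightarrow> a \<^bold>\<or> b \<in> carrier B"
    and meet_comm: "\<lbrakk>a \<in> carrier B; b \<in> carrier B\<rbrakk> \<Longrightarrow> a \<^bold>\<and> b = b \<^bold>\<and> a"
    and join_comm: "\<lbrakk>a \<in> carrier B; b \<in> carrier B\<rbrakk> \<Longrightarrow> a \<^bold>\<or> b = b \<^bold>\<or> a"
    and meet_assoc:
      "\<lbrakk>a \<in> carrier B; b \<in> carrier B; c \<in> carrier B\<rbrakk> \<Longrightarrow> (a \<^bold>\<and> b) \<^bold>\<and> c = a \<^bold>\<and> (b \<^bold>\<and> c)"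
    and meet_join_distrib:
      "\<lbrakk>a \<in> carrier B; b \<in> carrier B; c \<in> carrier B\<rbrakk>
        \<Longrightarrow> a \<^bold>\<and> (b \<^bold>\<or> c) = (a \<^bold>\<and> b) \<^bold>\<or> (a \<^bold>\<and> c)"
    and join_zero [simp]: "a \<in> carrier B \<Longrightarrow> a \<^bold>\<or> \<^bold>0 = a"
    and ex_rel_compl:
      "\<lbrakk>a \<in> carrier B; b \<in> carrier B; a \<preceq> b\<rbrakk>
        \<Longrightarrow> \<exists>x\<in>carrier B. x \<^bold>\<or> a = b \<and> x \<^bold>\<and> a = \<^bold>0"
    and join_idem [simp]: "a \<in> carrier B \<Longrightarrow> a \<^bold>\<or> a = a"
    and meet_idem [simp]: "a \<in> carrier B \<Longrightarrow> a \<^bold>\<and> a = a"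

text \<open>\<open>rel_compl B b a\<close> is \<open>b \<setminus> a\<close>; it is meaningful only for \<open>a \<preceq>\<^bsub>B\<^esub> b\<close>
  (existence is an axiom, uniqueness is \<open>rel_compl_unique\<close> below).\<close>

definition rel_compl :: "('b, 'm) gen_boolean_scheme \<Rightarrow> 'b \<Rightarrow> 'b \<Rightarrow> 'b" where
  "rel_compl B b a = (THE x. x \<in> carrier B \<and> x \<^bold>\<or>\<^bsub>B\<^esub> a = b \<and> x \<^bold>\<and>\<^bsub>B\<^esub> a = \<^bold>0\<^bsub>B\<^esub>)"

definition is_gunit :: "('b, 'm) gen_boolean_scheme \<Rightarrow> 'b \<Rightarrow> bool" where
  "is_gunit B u \<longleftrightarrow> u \<in> carrier B \<and> (\<forall>a\<in>carrier B. a \<^bold>\<and>\<^bsub>B\<^esub> u = a)"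

definition is_boolean :: "('b, 'm) gen_boolean_scheme \<Rightarrow> bool" where
  "is_boolean B \<longleftrightarrow> generalized_boolean_algebra B \<and> (\<exists>u. is_gunit B u)"

definition gunit :: "('b, 'm) gen_boolean_scheme \<Rightarrow> 'b"  ("\<^bold>1\<index>") where
  "\<^bold>1\<^bsub>B\<^esub> = (THE u. is_gunit B u)"

definition gneg :: "('b, 'm) gen_boolean_scheme \<Rightarrow> 'b \<Rightarrow> 'b" where
  "gneg B a = rel_compl B \<^bold>1\<^bsub>B\<^esub> a"

text \<open>An ideal \<open>C\<close>, viewed as an algebra with the restricted operations, is
  \<open>B\<lparr>carrier := C\<rparr>\<close>.\<close>

definition gideal :: "('b, 'm) gen_boolean_scheme \<Rightarrow> 'b set \<Rightarrow> bool" where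
  "gideal B C \<longleftrightarrow> C \<noteq> {} \<and> C \<subseteq> carrier B
     \<and> (\<forall>a\<in>C. \<forall>b\<in>C. a \<^bold>\<or>\<^bsub>B\<^esub> b \<in> C)
     \<and> (\<forall>a\<in>carrier B. \<forall>b\<in>C. a \<preceq>\<^bsub>B\<^esub> b \<longrightarrow> a \<in> C)"

text \<open>Joins and meets of finite families. A nonempty meet must make sense without a unit,
  so the fold starts at an arbitrary member of the family; by idempotence the choice is
  irrelevant (see \<open>gmeets_insert\<close> below).\<close>

definition gjoins :: "('b, 'm) gen_boolean_scheme \<Rightarrow> ('i \<Rightarrow> 'b) \<Rightarrow> 'i set \<Rightarrow> 'b" where
  "gjoins B f I = foldD (carrier B) (\<lambda>i b. f i \<^bold>\<or>\<^bsub>B\<^esub> b) \<^bold>0\<^bsub>B\<^esub> I"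

definition gmeets :: "('b, 'm) gen_boolean_scheme \<Rightarrow> ('i \<Rightarrow> 'b) \<Rightarrow> 'i set \<Rightarrow> 'b" where
  "gmeets B f I =
     (if I = {} then \<^bold>1\<^bsub>B\<^esub>
      else foldD (carrier B) (\<lambda>i b. f i \<^bold>\<and>\<^bsub>B\<^esub> b) (f (SOME i. i \<in> I)) I)"


section \<open>Representations of semilattices\<close>

definition is_cover :: "'e::{semilattice_inf,order_bot} set \<Rightarrow> 'e set \<Rightarrow> bool" where
  "is_cover Z F \<longleftrightarrow> Z \<subseteq> F \<and> (\<forall>x\<in>F. x \<noteq> bot \<longrightarrow> (\<exists>z\<in>Z. inf z x \<noteq> bot))"

text \<open>\<open>relset X Y\<close> is the set \<open>E\<^sup>X\<^sup>,\<^sup>Y\<close>, with \<open>E\<close> the whole type.\<close>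

definition relset ::
  "'e::{semilattice_inf,order_bot} set \<Rightarrow> 'e set \<Rightarrow> 'e set" where
  "relset X Y = {z. (\<forall>x\<in>X. z \<le> x) \<and> (\<forall>y\<in>Y. inf z y = bot)}"

definition representation ::
  "('b, 'm) gen_boolean_scheme \<Rightarrow> ('e::{semilattice_inf,order_bot} \<Rightarrow> 'b) \<Rightarrow> bool" where
  "representation B \<pi> \<longleftrightarrow> (\<forall>x. \<pi> x \<in> carrier B) \<and> \<pi> bot = \<^bold>0\<^bsub>B\<^esub>
     \<and> (\<forall>x y. \<pi> (inf x y) = \<pi> x \<^bold>\<and>\<^bsub>B\<^esub> \<pi> y)"

definition tight_boolean ::
  "('b, 'm) gen_boolean_scheme \<Rightarrow> ('e::{semilattice_inf,order_bot} \<Rightarrow> 'b) \<Rightarrow> bool" where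
  "tight_boolean B \<pi> \<longleftrightarrow> is_boolean B
     \<and> (\<forall>X Y Z. finite X \<and> finite Y \<and> finite Z \<and> is_cover Z (relset X Y) \<longrightarrow>
          gjoins B \<pi> Z = gmeets B \<pi> X \<^bold>\<and>\<^bsub>B\<^esub> gmeets B (\<lambda>y. gneg B (\<pi> y)) Y)"

text \<open>Below \<open>X\<close> is automatically nonempty, since for \<open>X = {}\<close> the set \<open>Z \<union> Y\<close> would
  be a finite cover of the whole semilattice; so \<open>gmeets\<close> does not refer to a unit.\<close>

definition tight_no_cover ::
  "('b, 'm) gen_boolean_scheme \<Rightarrow> ('e::{semilattice_inf,order_bot} \<Rightarrow> 'b) \<Rightarrow> bool" where
  "tight_no_cover B \<pi> \<longleftrightarrow> \<not> (\<exists>Z :: 'e set. finite Z \<and> is_cover Z UNIV)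
     \<and> (\<forall>X Y Z. finite X \<and> finite Y \<and> finite Z \<and> is_cover Z (relset X Y) \<longrightarrow>
          gjoins B \<pi> Z =
            rel_compl B (gmeets B \<pi> X) (gmeets B \<pi> X \<^bold>\<and>\<^bsub>B\<^esub> gjoins B \<pi> Y))"

definition tight ::
  "('b, 'm) gen_boolean_scheme \<Rightarrow> ('e::{semilattice_inf,order_bot} \<Rightarrow> 'b) \<Rightarrow> bool" where
  "tight B \<pi> \<longleftrightarrow> generalized_boolean_algebra B \<and> representation B \<pi>
     \<and> (tight_boolean B \<pi> \<or> tight_no_cover B \<pi>)"

definition cover_to_join ::
  "('b, 'm) gen_boolean_scheme \<Rightarrow> ('e::{semilattice_inf,order_bot} \<Rightarrow> 'b) \<Rightarrow> bool" where
  "cover_to_join B \<pi> \<longleftrightarrow>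
     (\<forall>x Z. finite Z \<and> is_cover Z {z. z \<le> x} \<longrightarrow> gjoins B \<pi> Z = \<pi> x)"


section \<open>Well-definedness\<close>

context generalized_boolean_algebra
begin

lemma meet_left_comm:
  assumes "a \<in> carrier B" "b \<in> carrier B" "c \<in> carrier B"
  shows "a \<^bold>\<and> (b \<^bold>\<and> c) = b \<^bold>\<and> (a \<^bold>\<and> c)"
  using assms by (metis meet_assoc meet_comm)

lemma meet_zero [simp]:
  assumes a: "a \<in> carrier B"
  shows "a \<^bold>\<and> \<^bold>0 = \<^bold>0"
proof -
  obtain x where x: "x \<in> carrier B" "x \<^bold>\<and> a = \<^bold>0"
    using ex_rel_compl[OF a a] a by (auto simp: gle_def)
  have "a \<^bold>\<and> (x \<^bold>\<and> a) = x \<^bold>\<and> a"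
    using a x(1) by (metis meet_idem meet_left_comm)
  then show ?thesis using x by simp
qed

lemma disjoint_join_meet:
  assumes "x \<in> carrier B" "a \<in> carrier B" "x \<^bold>\<and> a = \<^bold>0"
  shows "x \<^bold>\<and> (x \<^bold>\<or> a) = x"
  using assms by (simp add: meet_join_distrib)

lemma rel_compl_unique:
  assumes x: "x \<in> carrier B" "x \<^bold>\<or> a = b" "x \<^bold>\<and> a = \<^bold>0"
    and y: "y \<in> carrier B" "y \<^bold>\<or> a = b" "y \<^bold>\<and> a = \<^bold>0"
    and a: "a \<in> carrier B"
  shows "x = y"
proof -
  have "x = x \<^bold>\<and> (y \<^bold>\<or> a)" using disjoint_join_meet[OF x(1) a x(3)] x(2) y(2) by simp
  also have "\<dots> = x \<^bold>\<and> y" using x(1,3) y(1) a by (simp add: meet_join_distrib)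
  also have "\<dots> = y \<^bold>\<and> x" using x(1) y(1) by (rule meet_comm)
  also have "\<dots> = y \<^bold>\<and> (x \<^bold>\<or> a)" using x(1) y(1,3) a by (simp add: meet_join_distrib)
  also have "\<dots> = y" using disjoint_join_meet[OF y(1) a y(3)] x(2) y(2) by simp
  finally show ?thesis .
qed

lemma rel_compl_eqI:
  assumes "x \<in> carrier B" "a \<in> carrier B" "x \<^bold>\<or> a = b" "x \<^bold>\<and> a = \<^bold>0"
  shows "rel_compl B b a = x"
  unfolding rel_compl_def using assms rel_compl_unique by (intro the_equality) blast+

lemma gunit_eqI: "is_gunit B u \<Longrightarrow> \<^bold>1 = u"
  unfolding gunit_def is_gunit_def by (rule the_equality) (auto, metis meet_comm)

lemma absorb:
  assumes a: "a \<in> carrier B" and b: "b \<in> carrier B"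
  shows "a \<^bold>\<and> (a \<^bold>\<or> b) = a"
proof -
  let ?c = "a \<^bold>\<and> b"
  let ?u = "a \<^bold>\<or> ?c"
  have u: "a \<^bold>\<and> (a \<^bold>\<or> b) = ?u" using a b by (simp add: meet_join_distrib)
  have "a \<^bold>\<and> ?u = ?u" using a b by (simp add: meet_join_distrib flip: meet_assoc)
  then have "?u \<preceq> a" using a b by (simp add: gle_def meet_comm)
  then obtain y where y: "y \<in> carrier B" "y \<^bold>\<or> ?u = a" "y \<^bold>\<and> ?u = \<^bold>0"
    using ex_rel_compl[of ?u a] a b by auto
  have ya: "y \<^bold>\<and> a = y" using disjoint_join_meet[of y ?u] a b y by simp
  have y0: "y \<^bold>\<or> (y \<^bold>\<and> ?c) = \<^bold>0"
    using y a b ya by (simp add: meet_join_distrib)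
  have "?c \<^bold>\<and> (y \<^bold>\<or> (y \<^bold>\<and> ?c)) = (?c \<^bold>\<and> y) \<^bold>\<or> (?c \<^bold>\<and> (y \<^bold>\<and> ?c))"
    using y a b by (intro meet_join_distrib) auto
  also have "?c \<^bold>\<and> (y \<^bold>\<and> ?c) = y \<^bold>\<and> ?c"
    using y(1) a b meet_left_comm[of ?c y ?c] by simp
  also have "?c \<^bold>\<and> y = y \<^bold>\<and> ?c" using y(1) a b by (simp add: meet_comm)
  finally have "y \<^bold>\<and> ?c = \<^bold>0" using y0 y a b by simp
  then have "y = \<^bold>0" using y0 y by simp
  then have "a = \<^bold>0 \<^bold>\<or> ?u" using y(2) by simp
  also have "\<dots> = ?u" using a b join_comm[of "\<^bold>0" ?u] by simp
  finally show ?thesis using u by simp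
qed

lemma le_antisym:
  "\<lbrakk>a \<in> carrier B; b \<in> carrier B; a \<preceq> b; b \<preceq> a\<rbrakk> \<Longrightarrow> a = b"
  unfolding gle_def by (metis meet_comm)

lemma le_trans:
  "\<lbrakk>a \<in> carrier B; b \<in> carrier B; c \<in> carrier B; a \<preceq> b; b \<preceq> c\<rbrakk> \<Longrightarrow> a \<preceq> c"
  unfolding gle_def using meet_assoc[of a b c] by simp

lemma le_join1: "\<lbrakk>a \<in> carrier B; b \<in> carrier B\<rbrakk> \<Longrightarrow> a \<preceq> a \<^bold>\<or> b"
  by (simp add: gle_def absorb)

lemma le_join2: "\<lbrakk>a \<in> carrier B; b \<in> carrier B\<rbrakk> \<Longrightarrow> b \<preceq> a \<^bold>\<or> b"
  by (metis join_comm le_join1)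

lemma join_least:
  assumes "a \<in> carrier B" "b \<in> carrier B" "c \<in> carrier B" "a \<preceq> c" "b \<preceq> c"
  shows "a \<^bold>\<or> b \<preceq> c"
proof -
  have "(a \<^bold>\<or> b) \<^bold>\<and> c = (c \<^bold>\<and> a) \<^bold>\<or> (c \<^bold>\<and> b)"
    using assms(1-3) by (simp add: meet_comm[of _ c] meet_join_distrib)
  also have "c \<^bold>\<and> a = a" using assms(1,3,4) meet_comm[of a c] by (simp add: gle_def)
  also have "c \<^bold>\<and> b = b" using assms(2,3,5) meet_comm[of b c] by (simp add: gle_def)
  finally show ?thesis by (simp add: gle_def)
qed

lemma join_assoc:
  assumes "a \<in> carrier B" "b \<in> carrier B" "c \<in> carrier B"
  shows "(a \<^bold>\<or> b) \<^bold>\<or> c = a \<^bold>\<or> (b \<^bold>\<or> c)"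
proof (rule le_antisym)
  have cl: "a \<^bold>\<or> b \<in> carrier B" "b \<^bold>\<or> c \<in> carrier B" using assms by auto
  have r: "(a \<^bold>\<or> b) \<^bold>\<or> c \<in> carrier B" "a \<^bold>\<or> (b \<^bold>\<or> c) \<in> carrier B" using assms by auto
  have "b \<preceq> a \<^bold>\<or> (b \<^bold>\<or> c)"
    by (rule le_trans[OF assms(2) cl(2) r(2)], rule le_join1, (rule assms cl le_join2)+)
  moreover have "c \<preceq> a \<^bold>\<or> (b \<^bold>\<or> c)"
    by (rule le_trans[OF assms(3) cl(2) r(2)]) (rule le_join2 assms cl)+
  ultimately show "(a \<^bold>\<or> b) \<^bold>\<or> c \<preceq> a \<^bold>\<or> (b \<^bold>\<or> c)"
    using assms cl r by (simp add: join_least le_join1)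
  have "a \<preceq> (a \<^bold>\<or> b) \<^bold>\<or> c"
    by (rule le_trans[OF assms(1) cl(1) r(1)]) (rule le_join1 assms cl)+
  moreover have "b \<preceq> (a \<^bold>\<or> b) \<^bold>\<or> c"
    by (rule le_trans[OF assms(2) cl(1) r(1)], rule le_join2, (rule assms cl le_join1)+)
  ultimately show "a \<^bold>\<or> (b \<^bold>\<or> c) \<preceq> (a \<^bold>\<or> b) \<^bold>\<or> c"
    using assms cl r by (simp add: join_least le_join2)
qed (use assms in auto)

lemma join_left_comm:
  "\<lbrakk>a \<in> carrier B; b \<in> carrier B; c \<in> carrier B\<rbrakk> \<Longrightarrow> a \<^bold>\<or> (b \<^bold>\<or> c) = b \<^bold>\<or> (a \<^bold>\<or> c)"
  by (metis join_assoc join_comm)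

lemma LCD_join: "f \<in> I \<rightarrow> carrier B \<Longrightarrow> LCD I (carrier B) (\<lambda>i b. f i \<^bold>\<or> b)"
  by unfold_locales (auto intro!: join_left_comm)

lemma LCD_meet: "f \<in> I \<rightarrow> carrier B \<Longrightarrow> LCD I (carrier B) (\<lambda>i b. f i \<^bold>\<and> b)"
  by unfold_locales (auto intro!: meet_left_comm)

lemma gjoins_empty [simp]: "gjoins B f {} = \<^bold>0"
  by (simp add: gjoins_def)

lemma gjoins_closed [simp]:
  "\<lbrakk>finite I; f \<in> I \<rightarrow> carrier B\<rbrakk> \<Longrightarrow> gjoins B f I \<in> carrier B"
  using LCD.foldD_closed[OF LCD_join] by (fastforce simp: gjoins_def)

lemma gjoins_insert:
  assumes "finite I" "i \<notin> I" "f \<in> insert i I \<rightarrow> carrier B"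
  shows "gjoins B f (insert i I) = f i \<^bold>\<or> gjoins B f I"
  unfolding gjoins_def using assms by (intro LCD.foldD_insert[OF LCD_join[OF assms(3)]]) auto

lemma gmeets_fold_start:
  assumes "finite I" "f \<in> I \<rightarrow> carrier B" "i \<in> I" "j \<in> I"
  shows "foldD (carrier B) (\<lambda>i b. f i \<^bold>\<and> b) (f i) I
       = foldD (carrier B) (\<lambda>i b. f i \<^bold>\<and> b) (f j) I"
proof -
  interpret LCD I "carrier B" "\<lambda>i b. f i \<^bold>\<and> b" by (rule LCD_meet[OF assms(2)])
  let ?F = "\<lambda>e J. foldD (carrier B) (\<lambda>i b. f i \<^bold>\<and> b) e J"
  have absorb: "?F e I = ?F (f k \<^bold>\<and> e) I" if "k \<in> I" "e \<in> carrier B" for k e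
  proof -
    have kI: "I = insert k (I - {k})" using that by auto
    have fk: "f k \<in> carrier B" using that assms by auto
    have fin: "finite (I - {k})" using assms by auto
    have "?F e I = f k \<^bold>\<and> ?F e (I - {k})"
      by (subst kI, rule foldD_insert) (use that fin in auto)
    also have "\<dots> = f k \<^bold>\<and> (f k \<^bold>\<and> ?F e (I - {k}))"
      using fk fin that foldD_closed[OF fin, of e] by (simp flip: meet_assoc)
    also have "f k \<^bold>\<and> ?F e (I - {k}) = ?F (f k \<^bold>\<and> e) (I - {k})"
      by (rule foldD_commute) (use that fin in auto)
    also have "f k \<^bold>\<and> ?F (f k \<^bold>\<and> e) (I - {k}) = ?F (f k \<^bold>\<and> e) I"
      by (subst (2) kI, rule foldD_insert[symmetric]) (use that fin fk in auto)
    finally show ?thesis .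
  qed
  have c: "f i \<in> carrier B" "f j \<in> carrier B" using assms by auto
  show ?thesis using absorb[of i "f j"] absorb[of j "f i"] assms c by (simp add: meet_comm)
qed

lemma gmeets_singleton [simp]: "f i \<in> carrier B \<Longrightarrow> gmeets B f {i} = f i"
  using LCD.foldD_insert[OF LCD_meet, of f "{i}" "{}" i "f i"] by (simp add: gmeets_def)

lemma gmeets_insert:
  assumes "finite I" "I \<noteq> {}" "i \<notin> I" "f \<in> insert i I \<rightarrow> carrier B"
  shows "gmeets B f (insert i I) = f i \<^bold>\<and> gmeets B f I"
proof -
  interpret LCD "insert i I" "carrier B" "\<lambda>i b. f i \<^bold>\<and> b" by (rule LCD_meet[OF assms(4)])
  have s: "(SOME k. k \<in> insert i I) \<in> insert i I" "(SOME k. k \<in> I) \<in> I"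
    using assms by (metis insertI1 someI, metis all_not_in_conv someI)
  have c: "f (SOME k. k \<in> I) \<in> carrier B" using s assms by auto
  have "gmeets B f (insert i I)
      = foldD (carrier B) (\<lambda>i b. f i \<^bold>\<and> b) (f (SOME k. k \<in> I)) (insert i I)"
    using gmeets_fold_start[OF _ assms(4) s(1), of "SOME k. k \<in> I"] s(2) assms(1)
    by (simp only: gmeets_def insert_not_empty if_False finite_insert insertI2)
  also have "\<dots> = f i \<^bold>\<and> gmeets B f I"
    unfolding gmeets_def using assms c by (subst foldD_insert) auto
  finally show ?thesis .
qed

lemma gideal_algebra:
  assumes "gideal B C"
  shows "generalized_boolean_algebra (B\<lparr>carrier := C\<rparr>)"
proof -
  have sub: "\<And>a. a \<in> C \<Longrightarrow> a \<in> carrier B"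
    and jc: "\<And>a b. \<lbrakk>a \<in> C; b \<in> C\<rbrakk> \<Longrightarrow> a \<^bold>\<or> b \<in> C"
    and dn: "\<And>a b. \<lbrakk>a \<in> carrier B; b \<in> C; a \<preceq> b\<rbrakk> \<Longrightarrow> a \<in> C"
    and ne: "C \<noteq> {}"
    using assms unfolding gideal_def by blast+
  have le: "a \<preceq>\<^bsub>B\<lparr>carrier := C\<rparr>\<^esub> b \<longleftrightarrow> a \<preceq> b" for a b by (simp add: gle_def)
  obtain c where "c \<in> C" using ne by auto
  then have z: "\<^bold>0 \<in> C" using dn[of "\<^bold>0" c] sub by (simp add: gle_def meet_comm)
  have mc: "a \<^bold>\<and> b \<in> C" if "a \<in> C" "b \<in> C" for a b
    using dn[of "a \<^bold>\<and> b" b] that sub by (simp add: gle_def meet_assoc)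
  have rc: "\<exists>x\<in>C. x \<^bold>\<or> a = b \<and> x \<^bold>\<and> a = \<^bold>0"
    if ab: "a \<in> C" "b \<in> C" "a \<preceq> b" for a b
  proof -
    obtain x where x: "x \<in> carrier B" "x \<^bold>\<or> a = b" "x \<^bold>\<and> a = \<^bold>0"
      using ex_rel_compl[of a b] ab sub by auto
    then have "x \<in> C" using dn[of x b] le_join1[of x a] ab sub by auto
    then show ?thesis using x by auto
  qed
  show ?thesis
  proof
    show "\<^bold>0\<^bsub>B\<lparr>carrier := C\<rparr>\<^esub> \<in> carrier (B\<lparr>carrier := C\<rparr>)" using z by simp
  qed (simp_all add: mc jc rc sub le meet_assoc meet_join_distrib,
       (rule meet_comm join_comm; rule sub; assumption)+)
qed

end

end

theory Submission
  imports Defs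
begin

text \<open>
  A finite cover \<open>Z\<close> of \<open>E\<^sup>X\<^sup>,\<^sup>Y\<close> with \<open>X \<noteq> {}\<close> and \<open>x = \<And>X\<close> becomes a finite cover of
  \<open>{z. z \<le> x}\<close> once the elements \<open>x \<and> y\<close>, \<open>y \<in> Y\<close>, are added. So the cover-to-join property says
  that \<open>\<Or>\<pi>(Z)\<close> and \<open>\<pi>(x) \<and> \<Or>\<pi>(Y)\<close> join to \<open>\<pi>(x)\<close>; they are disjoint, hence the first is
  the relative complement of the second. If \<open>E\<close> has a finite cover \<open>W\<close>, then \<open>w = \<Or>\<pi>(W)\<close> lies
  above the whole range of \<open>\<pi>\<close>, because \<open>{x \<and> z | z \<in> W}\<close> covers \<open>{z. z \<le> x}\<close>. In the principal
  ideal of \<open>w\<close>, which has the unit \<open>w\<close>, the same argument then works for \<open>X = {}\<close>.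
\<close>

section \<open>Enlarging finite covers\<close>

text \<open>A nonzero \<open>w\<close> below all of \<open>X\<close> either lies in
  \<open>relset X Y\<close>, and then meets a member of \<open>Z\<close>, or fails to be orthogonal
  to some member of \<open>Y\<close>. Describing \<open>x\<close> by its lower set lets the first
  claim serve both \<open>Inf_fin X\<close> and a single element.\<close>

lemma is_cover_relset_Un:
  assumes "is_cover Z (relset X Y)"
  shows "(\<And>z. z \<le> x \<longleftrightarrow> (\<forall>u\<in>X. z \<le> u)) \<Longrightarrow> is_cover (Z \<union> inf x ` Y) {z. z \<le> x}"
    and "X = {} \<Longrightarrow> is_cover (Z \<union> Y) UNIV"
proof -
  have met: "\<exists>z\<in>Z \<union> Y. inf z w \<noteq> bot" if "w \<noteq> bot" "\<forall>u\<in>X. w \<le> u" for w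
  proof (cases "w \<in> relset X Y")
    case True
    then show ?thesis using assms that unfolding is_cover_def by blast
  next
    case False
    then show ?thesis using that unfolding relset_def by (auto simp: inf_commute)
  qed
  show "is_cover (Z \<union> Y) UNIV" if "X = {}"
    using met that by (simp add: is_cover_def)
  show "is_cover (Z \<union> inf x ` Y) {z. z \<le> x}" if x: "\<And>z. z \<le> x \<longleftrightarrow> (\<forall>u\<in>X. z \<le> u)"
    unfolding is_cover_def
  proof (intro conjI ballI impI)
    have "Z \<subseteq> {z. z \<le> x}" using assms x by (auto simp: is_cover_def relset_def)
    then show "Z \<union> inf x ` Y \<subseteq> {z. z \<le> x}" by auto
    fix w assume w: "w \<in> {z. z \<le> x}" "w \<noteq> bot"
    then obtain z where z: "z \<in> Z \<union> Y" "inf z w \<noteq> bot" using met x by blast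
    \<comment> \<open>Since \<open>w\<close> is below \<open>x\<close>, cutting \<open>z\<close>
      down to \<open>inf x z\<close> does not change its meet with \<open>w\<close>.\<close>
    have "inf (inf x z) w = inf z w"
      using w by (metis inf.absorb2 inf.assoc inf.commute mem_Collect_eq)
    then show "\<exists>z\<in>Z \<union> inf x ` Y. inf z w \<noteq> bot" using z by (metis UnE UnI1 UnI2 imageI)
  qed
qed

text \<open>Only \<open>bot\<close> is orthogonal to all of \<open>W\<close>, so the empty set
  covers \<open>relset {x} W\<close>; the previous lemma with \<open>Y = W\<close> then adds exactly
  the elements \<open>inf x z\<close>.\<close>

lemma is_cover_inf_image:
  assumes "is_cover W UNIV"
  shows "is_cover (inf x ` W) {z. z \<le> x}"
proof -
  have "z = bot" if "z \<in> relset {x} W" for z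
  proof (rule ccontr)
    assume "z \<noteq> bot"
    then obtain y where "y \<in> W" "inf y z \<noteq> bot" using assms by (auto simp: is_cover_def)
    then show False using that by (simp add: relset_def inf_commute)
  qed
  then have "is_cover {} (relset {x} W)" by (auto simp: is_cover_def)
  from is_cover_relset_Un(1)[OF this, of x] show ?thesis by simp
qed

context generalized_boolean_algebra
begin

section \<open>Order and finite joins in a generalized Boolean algebra\<close>

lemma meet_lower1: "\<lbrakk>a \<in> carrier B; b \<in> carrier B\<rbrakk> \<Longrightarrow> a \<^bold>\<and> b \<preceq> a"
  using meet_left_comm[of a b a] by (simp add: gle_def meet_assoc meet_comm[of b a])

lemma zero_le [simp]: "a \<in> carrier B \<Longrightarrow> \<^bold>0 \<preceq> a"
  using meet_comm[of "\<^bold>0" a] by (simp add: gle_def)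

lemma le_refl [simp]: "a \<in> carrier B \<Longrightarrow> a \<preceq> a"
  by (simp add: gle_def)

lemma le_joinI1:
  "\<lbrakk>a \<in> carrier B; b \<in> carrier B; c \<in> carrier B; a \<preceq> b\<rbrakk> \<Longrightarrow> a \<preceq> b \<^bold>\<or> c"
  using le_trans[of a b "b \<^bold>\<or> c"] le_join1 by simp

lemma le_joinI2:
  "\<lbrakk>a \<in> carrier B; b \<in> carrier B; c \<in> carrier B; a \<preceq> c\<rbrakk> \<Longrightarrow> a \<preceq> b \<^bold>\<or> c"
  using le_trans[of a c "b \<^bold>\<or> c"] le_join2 by simp

lemma meet_mono2:
  assumes "a \<in> carrier B" "b \<in> carrier B" "c \<in> carrier B" "b \<preceq> c"
  shows "a \<^bold>\<and> b \<preceq> a \<^bold>\<and> c"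
proof -
  have "(a \<^bold>\<and> b) \<^bold>\<and> (a \<^bold>\<and> c) = (a \<^bold>\<and> a) \<^bold>\<and> (b \<^bold>\<and> c)"
    using assms(1-3) by (metis meet_assoc meet_left_comm meet_closed)
  also have "\<dots> = a \<^bold>\<and> (b \<^bold>\<and> c)" using assms(1-3) by (simp flip: meet_assoc)
  finally show ?thesis using assms(4) by (simp add: gle_def)
qed

lemma gjoins_upper:
  assumes "finite I" "f \<in> I \<rightarrow> carrier B" "i \<in> I"
  shows "f i \<preceq> gjoins B f I"
proof -
  have I: "I = insert i (I - {i})" using assms by auto
  have c: "f i \<in> carrier B" "gjoins B f (I - {i}) \<in> carrier B"
    using assms by (auto simp: Pi_iff)
  have "gjoins B f I = f i \<^bold>\<or> gjoins B f (I - {i})"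
    by (subst I, rule gjoins_insert) (use assms in auto)
  then show ?thesis using le_join1 c by simp
qed

lemma gjoins_least:
  assumes "finite I" "f \<in> I \<rightarrow> carrier B" "c \<in> carrier B" "\<And>i. i \<in> I \<Longrightarrow> f i \<preceq> c"
  shows "gjoins B f I \<preceq> c"
  using assms by (induction I) (auto simp: gjoins_insert intro!: join_least)

lemma meet_gjoins_eq_zero:
  assumes "finite I" "f \<in> I \<rightarrow> carrier B" "a \<in> carrier B" "\<And>i. i \<in> I \<Longrightarrow> a \<^bold>\<and> f i = \<^bold>0"
  shows "a \<^bold>\<and> gjoins B f I = \<^bold>0"
  using assms by (induction I) (auto simp: gjoins_insert meet_join_distrib)

section \<open>Ideals as algebras\<close>

text \<open>The carrier is a parameter of \<open>foldD\<close>, so the two joins are different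
  terms; they agree because both satisfy the same recursion over \<open>I\<close>.\<close>

lemma gjoins_ideal:
  assumes "gideal B C" "finite I" "f \<in> I \<rightarrow> C"
  shows "gjoins (B\<lparr>carrier := C\<rparr>) f I = gjoins B f I"
proof -
  interpret C: generalized_boolean_algebra "B\<lparr>carrier := C\<rparr>"
    by (rule gideal_algebra[OF assms(1)])
  have "C \<subseteq> carrier B" using assms(1) by (simp add: gideal_def)
  then have "f \<in> I \<rightarrow> carrier B" using assms(3) by auto
  with assms(2,3) show ?thesis
    using C.gjoins_empty by (induction I) (auto simp: gjoins_insert C.gjoins_insert)
qed

lemma gideal_principal:
  assumes w: "w \<in> carrier B"
  shows "gideal B {b \<in> carrier B. b \<preceq> w}"
  unfolding gideal_def
proof (intro conjI ballI impI)
  show "{b \<in> carrier B. b \<preceq> w} \<noteq> {}" using w zero_le by blast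
  fix a b assume b: "b \<in> {b \<in> carrier B. b \<preceq> w}"
  show "a \<^bold>\<or> b \<in> {b \<in> carrier B. b \<preceq> w}" if "a \<in> {b \<in> carrier B. b \<preceq> w}"
    using that b w by (simp add: join_least)
  show "a \<in> {b \<in> carrier B. b \<preceq> w}" if "a \<in> carrier B" "a \<preceq> b"
    using that b w le_trans[of a b w] by simp
qed auto

lemma gideal_carrier: "gideal B (carrier B)"
  unfolding gideal_def by auto

section \<open>Units, negation and a De Morgan law\<close>

lemma rel_compl_zero: "a \<in> carrier B \<Longrightarrow> rel_compl B a \<^bold>0 = a"
  by (rule rel_compl_eqI) auto

lemma unit_closed: "is_gunit B u \<Longrightarrow> \<^bold>1 \<in> carrier B"
  and meet_unit: "\<lbrakk>is_gunit B u; a \<in> carrier B\<rbrakk> \<Longrightarrow> a \<^bold>\<and> \<^bold>1 = a"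
  using gunit_eqI by (auto simp: is_gunit_def)

lemma gneg_compl:
  assumes "is_gunit B u" "a \<in> carrier B"
  shows "gneg B a \<in> carrier B" "gneg B a \<^bold>\<or> a = \<^bold>1" "gneg B a \<^bold>\<and> a = \<^bold>0"
proof -
  have "a \<preceq> \<^bold>1" using meet_unit[OF assms] by (simp add: gle_def)
  then obtain x where x: "x \<in> carrier B" "x \<^bold>\<or> a = \<^bold>1" "x \<^bold>\<and> a = \<^bold>0"
    using ex_rel_compl[of a "\<^bold>1"] unit_closed assms by blast
  then have "gneg B a = x" unfolding gneg_def using assms by (intro rel_compl_eqI)
  then show "gneg B a \<in> carrier B" "gneg B a \<^bold>\<or> a = \<^bold>1" "gneg B a \<^bold>\<and> a = \<^bold>0"
    using x by auto
qed

text \<open>Once there is a unit, the recursion may start from the empty meet, which permits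
  induction from the empty set.\<close>

lemma gmeets_unit_insert:
  assumes "is_gunit B u" "finite I" "i \<notin> I" "f \<in> insert i I \<rightarrow> carrier B"
  shows "gmeets B f (insert i I) = f i \<^bold>\<and> gmeets B f I"
proof (cases "I = {}")
  case True
  then show ?thesis
    using assms meet_unit gmeets_singleton[of f i] by (simp add: gmeets_def[of _ _ "{}"])
next
  case False
  then show ?thesis using assms by (intro gmeets_insert)
qed

text \<open>This is De Morgan's law in the form of the two equations that characterise a complement,
  ready for \<open>rel_compl_unique\<close>.\<close>

lemma gmeets_gneg_compl:
  assumes u: "is_gunit B u" and "finite I" "f \<in> I \<rightarrow> carrier B"
  shows "gmeets B (\<lambda>i. gneg B (f i)) I \<in> carrier B \<and>
    gmeets B (\<lambda>i. gneg B (f i)) I \<^bold>\<or> gjoins B f I = \<^bold>1 \<and>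
    gmeets B (\<lambda>i. gneg B (f i)) I \<^bold>\<and> gjoins B f I = \<^bold>0"
  using assms(2,3)
proof (induction I)
  case empty
  then show ?case using unit_closed[OF u] by (simp add: gmeets_def)
next
  case (insert i I)
  let ?n = "gneg B (f i)" and ?M = "gmeets B (\<lambda>i. gneg B (f i)) I" and ?J = "gjoins B f I"
  have f: "f i \<in> carrier B" "f \<in> I \<rightarrow> carrier B" using insert by auto
  note n = gneg_compl[OF u f(1)]
  have M: "?M \<in> carrier B" "?M \<^bold>\<or> ?J = \<^bold>1" "?M \<^bold>\<and> ?J = \<^bold>0" using insert f by auto
  have J: "?J \<in> carrier B" using insert f by simp
  have eqs: "gmeets B (\<lambda>i. gneg B (f i)) (insert i I) = ?n \<^bold>\<and> ?M"
    "gjoins B f (insert i I) = f i \<^bold>\<or> ?J"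
    using insert f gneg_compl(1)[OF u]
    by (auto intro!: gmeets_unit_insert[OF u] gjoins_insert simp: Pi_iff)
  let ?s = "(?n \<^bold>\<and> ?M) \<^bold>\<or> (f i \<^bold>\<or> ?J)"
  have s: "?s \<in> carrier B" using n M J f by simp
  have le: "?n \<^bold>\<and> ?M \<preceq> ?s" "f i \<preceq> ?s" "?J \<preceq> ?s"
    using n M J f by (simp_all add: le_joinI1 le_joinI2)
  \<comment> \<open>An upper bound argument replaces the dual distributive law: as \<open>?M\<close>
    and \<open>?J\<close> join to the unit, \<open>?n\<close> is the join of its meets with them,
    and both meets lie below \<open>?s\<close>. Hence \<open>?s\<close> is above \<open>?n\<close>
    and \<open>f i\<close>, which join to the unit.\<close>
  have "?n \<^bold>\<and> ?J \<preceq> ?s"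
    using le_trans[OF _ _ s meet_lower1[of ?J ?n] le(3)] n J meet_comm[of ?n ?J] by simp
  then have "(?n \<^bold>\<and> ?M) \<^bold>\<or> (?n \<^bold>\<and> ?J) \<preceq> ?s" using n M J s le by (simp add: join_least)
  then have "?n \<preceq> ?s"
    using meet_join_distrib[OF n(1) M(1) J] M(2) meet_unit[OF u n(1)] by simp
  then have "?n \<^bold>\<or> f i \<preceq> ?s" using n(1) f s le by (simp only: join_least)
  then have "\<^bold>1 \<preceq> ?s" using n by simp
  then have "?s = \<^bold>1"
    using meet_unit[OF u s] meet_comm[OF s unit_closed[OF u]] by (simp add: gle_def)
  moreover have "(?n \<^bold>\<and> ?M) \<^bold>\<and> (f i \<^bold>\<or> ?J) = \<^bold>0"
  proof -
    have "(?n \<^bold>\<and> ?M) \<^bold>\<and> f i = ?M \<^bold>\<and> (?n \<^bold>\<and> f i)"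
      using n M f meet_comm[of ?n ?M] by (simp add: meet_assoc)
    moreover have "(?n \<^bold>\<and> ?M) \<^bold>\<and> ?J = ?n \<^bold>\<and> (?M \<^bold>\<and> ?J)"
      using n M J by (simp add: meet_assoc)
    ultimately show ?thesis using n M f J by (simp add: meet_join_distrib)
  qed
  ultimately show ?case using eqs n M by simp
qed

section \<open>Representations and joins over covers\<close>

lemma representation_mono:
  assumes "representation B \<pi>" "x \<le> y"
  shows "\<pi> x \<preceq> \<pi> y"
  using assms by (metis representation_def gle_def inf.absorb1)

text \<open>This turns a meet taken in \<open>B\<close> into the value of \<open>\<pi>\<close> at
  one element of the semilattice, to which the cover-to-join property can be applied.\<close>

lemma representation_Inf_fin:
  assumes "representation B \<pi>" "finite X" "X \<noteq> {}"
  shows "\<pi> (Inf_fin X) = gmeets B \<pi> X"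
  using assms(2,3)
proof (induction X rule: finite_ne_induct)
  case (singleton x)
  then show ?case using assms(1) by (simp add: representation_def)
next
  case (insert x F)
  then show ?case
    using assms(1) gmeets_insert[of F x \<pi>] by (simp add: representation_def Pi_iff)
qed

text \<open>It is used for two covers: the one generating the ideal, and \<open>Z \<union> Y\<close>
  when \<open>X\<close> is empty.\<close>

lemma representation_le_gjoins_cover:
  assumes \<pi>: "representation B \<pi>" and "cover_to_join B \<pi>"
    and W: "finite W" "is_cover W UNIV"
  shows "\<pi> x \<preceq> gjoins B \<pi> W"
proof -
  have c: "\<pi> z \<in> carrier B" for z using \<pi> by (simp add: representation_def)
  have "gjoins B \<pi> (inf x ` W) \<preceq> gjoins B \<pi> W"
  proof (rule gjoins_least)
    fix i assume "i \<in> inf x ` W"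
    then obtain z where z: "z \<in> W" "i \<le> z" by auto
    then show "\<pi> i \<preceq> gjoins B \<pi> W"
      using le_trans[OF c c[of z], of "gjoins B \<pi> W" i] representation_mono[OF \<pi> z(2)]
        gjoins_upper[of W \<pi> z] W c by simp
  qed (use W c in auto)
  moreover have "gjoins B \<pi> (inf x ` W) = \<pi> x"
    using assms(2) W is_cover_inf_image by (auto simp: cover_to_join_def)
  ultimately show ?thesis by simp
qed

lemma relset_gjoins_disjoint:
  assumes \<pi>: "representation B \<pi>"
    and fin: "finite Y" "finite Z" and Z: "Z \<subseteq> relset X Y"
  shows "gjoins B \<pi> Z \<^bold>\<and> gjoins B \<pi> Y = \<^bold>0"
proof (intro meet_gjoins_eq_zero)
  have c: "\<pi> z \<in> carrier B" for z using \<pi> by (simp add: representation_def)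
  then show "\<pi> \<in> Y \<rightarrow> carrier B" "gjoins B \<pi> Z \<in> carrier B" using fin by auto
  fix y assume y: "y \<in> Y"
  \<comment> \<open>For fixed \<open>y\<close> the factors are swapped, so that the same
    distributivity lemma handles the inner join over \<open>Z\<close>.\<close>
  have "\<pi> y \<^bold>\<and> gjoins B \<pi> Z = \<^bold>0"
  proof (rule meet_gjoins_eq_zero)
    fix z assume "z \<in> Z"
    then have "inf y z = bot" using Z y by (auto simp: relset_def inf_commute)
    then show "\<pi> y \<^bold>\<and> \<pi> z = \<^bold>0" using \<pi> unfolding representation_def by metis
  qed (use c fin in auto)
  then show "gjoins B \<pi> Z \<^bold>\<and> \<pi> y = \<^bold>0"
    using meet_comm c fin gjoins_closed by auto
qed fact

text \<open>Together with \<open>relset_gjoins_disjoint\<close> this exhibits the join over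
  \<open>Z\<close> as a relative complement. That the left side is not too small comes from the
  enlarged cover; the other inequality is monotonicity of \<open>\<pi>\<close>.\<close>

lemma relset_gjoins_join:
  assumes \<pi>: "representation B \<pi>" and cj: "cover_to_join B \<pi>"
    and fin: "finite X" "finite Y" "finite Z" and Z: "is_cover Z (relset X Y)"
    and X: "X \<noteq> {}"
  shows "gjoins B \<pi> Z \<^bold>\<or> (gmeets B \<pi> X \<^bold>\<and> gjoins B \<pi> Y) = gmeets B \<pi> X"
proof -
  have c: "\<pi> z \<in> carrier B" for z using \<pi> by (simp add: representation_def)
  let ?x = "Inf_fin X" and ?Z = "gjoins B \<pi> Z" and ?Y = "gjoins B \<pi> Y"
  have ZY: "?Z \<in> carrier B" "?Y \<in> carrier B" using c fin by auto
  have x: "z \<le> ?x \<longleftrightarrow> (\<forall>u\<in>X. z \<le> u)" for z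
    using fin X by (simp add: Inf_fin.bounded_iff)
  let ?r = "?Z \<^bold>\<or> (\<pi> ?x \<^bold>\<and> ?Y)"
  have r: "?r \<in> carrier B" using ZY c by simp
  have "gjoins B \<pi> (Z \<union> inf ?x ` Y) = \<pi> ?x"
    using cj fin is_cover_relset_Un(1)[OF Z x] by (auto simp: cover_to_join_def)
  moreover have "gjoins B \<pi> (Z \<union> inf ?x ` Y) \<preceq> ?r"
  proof (rule gjoins_least)
    fix i assume "i \<in> Z \<union> inf ?x ` Y"
    then show "\<pi> i \<preceq> ?r"
    proof
      assume "i \<in> Z"
      then show ?thesis
        using gjoins_upper[of Z \<pi> i] c fin ZY by (simp add: le_joinI1)
    next
      assume "i \<in> inf ?x ` Y"
      then obtain y where y: "y \<in> Y" "i = inf ?x y" by auto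
      then have i: "\<pi> i = \<pi> ?x \<^bold>\<and> \<pi> y" using \<pi> by (simp add: representation_def)
      have "\<pi> y \<preceq> ?Y" using gjoins_upper[of Y \<pi> y] y fin c by simp
      then have "\<pi> i \<preceq> \<pi> ?x \<^bold>\<and> ?Y" using i meet_mono2 c ZY by simp
      then show ?thesis using c ZY by (simp add: le_joinI2)
    qed
  qed (use c fin r in auto)
  moreover have "?r \<preceq> \<pi> ?x"
  proof (rule join_least)
    have "Z \<subseteq> {z. z \<le> ?x}" using Z x by (auto simp: is_cover_def relset_def)
    then show "?Z \<preceq> \<pi> ?x"
      using fin c representation_mono[OF \<pi>] by (intro gjoins_least) auto
  qed (use c ZY meet_lower1 in auto)
  ultimately have "?r = \<pi> ?x" using le_antisym r c by metis
  then show ?thesis using representation_Inf_fin[OF \<pi> fin(1) X] by simp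
qed

section \<open>Tightness versus cover-to-join\<close>

lemma cover_to_join_imp_tight_no_cover:
  fixes \<pi> :: "'e::{semilattice_inf,order_bot} \<Rightarrow> 'b"
  assumes \<pi>: "representation B \<pi>" and cj: "cover_to_join B \<pi>"
    and nc: "\<nexists>Z. finite Z \<and> is_cover Z (UNIV :: 'e set)"
  shows "tight_no_cover B \<pi>"
  unfolding tight_no_cover_def
proof (intro conjI nc allI impI, elim conjE)
  fix X Y Z :: "'e set"
  assume fin: "finite X" "finite Y" "finite Z" and Z: "is_cover Z (relset X Y)"
  have c: "\<pi> z \<in> carrier B" for z using \<pi> by (simp add: representation_def)
  \<comment> \<open>For empty \<open>X\<close>, the set \<open>Z \<union> Y\<close> would be a
    finite cover of the whole semilattice.\<close>
  have X: "X \<noteq> {}" using is_cover_relset_Un(2)[OF Z] nc fin by auto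
  let ?a = "gmeets B \<pi> X" and ?J = "gjoins B \<pi> Y" and ?Z = "gjoins B \<pi> Z"
  have cl: "?a \<in> carrier B" "?J \<in> carrier B" "?Z \<in> carrier B"
    using representation_Inf_fin[OF \<pi> fin(1) X] c[of "Inf_fin X"] c fin by auto
  have "?Z \<^bold>\<and> ?J = \<^bold>0" using relset_gjoins_disjoint \<pi> fin Z by (auto simp: is_cover_def)
  then have "?Z \<^bold>\<and> (?a \<^bold>\<and> ?J) = \<^bold>0" using cl meet_left_comm[of ?Z ?a ?J] by simp
  then show "?Z = rel_compl B ?a (?a \<^bold>\<and> ?J)"
    using cl relset_gjoins_join[OF \<pi> cj fin Z X] by (intro rel_compl_eqI[symmetric]) auto
qed

lemma cover_to_join_imp_tight_boolean:
  fixes \<pi> :: "'e::{semilattice_inf,order_bot} \<Rightarrow> 'b"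
  assumes \<pi>: "representation B \<pi>" and cj: "cover_to_join B \<pi>"
    and W: "finite W" "is_cover W UNIV" "is_gunit B (gjoins B \<pi> W)"
  shows "tight_boolean B \<pi>"
  unfolding tight_boolean_def
proof (intro conjI allI impI, goal_cases)
  case 1
  show ?case unfolding is_boolean_def using W generalized_boolean_algebra_axioms by blast
next
  case (2 X Y Z)
  then have fin: "finite X" "finite Y" "finite Z" and Z: "is_cover Z (relset X Y)" by auto
  have c: "\<pi> z \<in> carrier B" for z using \<pi> by (simp add: representation_def)
  note unit = unit_closed[OF W(3)] meet_unit[OF W(3)]
  let ?a = "gmeets B \<pi> X" and ?J = "gjoins B \<pi> Y" and ?Z = "gjoins B \<pi> Z"
  let ?n = "gmeets B (\<lambda>y. gneg B (\<pi> y)) Y"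
  have JZ: "?J \<in> carrier B" "?Z \<in> carrier B" using c fin by auto
  have n: "?n \<in> carrier B" "?n \<^bold>\<or> ?J = \<^bold>1" "?n \<^bold>\<and> ?J = \<^bold>0"
    using gmeets_gneg_compl[OF W(3) fin(2), of \<pi>] c by auto
  \<comment> \<open>This extends \<open>relset_gjoins_join\<close> to empty \<open>X\<close>, where
    \<open>?a\<close> is the unit.\<close>
  have a: "?a \<in> carrier B \<and> ?Z \<^bold>\<or> (?a \<^bold>\<and> ?J) = ?a"
  proof (cases "X = {}")
    case True
    have cov: "is_cover (Z \<union> Y) UNIV" using is_cover_relset_Un(2)[OF Z True] .
    have s: "?Z \<^bold>\<or> ?J \<in> carrier B" using JZ by simp
    have zy: "\<pi> i \<preceq> ?Z \<^bold>\<or> ?J" if "i \<in> Z \<union> Y" for i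
      using that gjoins_upper[of Z \<pi> i] gjoins_upper[of Y \<pi> i] c fin JZ
      by (auto simp: le_joinI1 le_joinI2)
    have "gjoins B \<pi> (Z \<union> Y) \<preceq> ?Z \<^bold>\<or> ?J"
      using fin c s zy by (intro gjoins_least) auto
    \<comment> \<open>The join over the cover \<open>Z \<union> Y\<close> dominates the range of
      \<open>\<pi>\<close>, hence also the join over \<open>W\<close>, which is the unit.\<close>
    then have "\<pi> w \<preceq> ?Z \<^bold>\<or> ?J" for w
      using le_trans[OF c _ s representation_le_gjoins_cover[OF \<pi> cj _ cov]] fin c by auto
    then have "gjoins B \<pi> W \<preceq> ?Z \<^bold>\<or> ?J"
      using W c s by (intro gjoins_least) auto
    then have "\<^bold>1 \<preceq> ?Z \<^bold>\<or> ?J" using gunit_eqI[OF W(3)] by simp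
    then have "?Z \<^bold>\<or> ?J = \<^bold>1"
      using unit(2)[OF s] meet_comm[OF s unit(1)] by (simp add: gle_def)
    moreover have "\<^bold>1 \<^bold>\<and> ?J = ?J" using unit JZ meet_comm by metis
    ultimately show ?thesis using True unit by (simp add: gmeets_def)
  next
    case False
    then show ?thesis
      using relset_gjoins_join[OF \<pi> cj fin Z False]
        representation_Inf_fin[OF \<pi> fin(1) False] c[of "Inf_fin X"] by simp
  qed
  show ?case
  \<comment> \<open>Both sides of the tightness equation are complements of
    \<open>?a \<and> ?J\<close> relative to \<open>?a\<close>.\<close>
  proof (rule rel_compl_unique)
    show "?Z \<^bold>\<or> (?a \<^bold>\<and> ?J) = ?a" using a by simp
    have "?Z \<^bold>\<and> ?J = \<^bold>0" using relset_gjoins_disjoint \<pi> fin Z by (auto simp: is_cover_def)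
    then show "?Z \<^bold>\<and> (?a \<^bold>\<and> ?J) = \<^bold>0" using a JZ meet_left_comm[of ?Z ?a ?J] by simp
    show "(?a \<^bold>\<and> ?n) \<^bold>\<or> (?a \<^bold>\<and> ?J) = ?a"
      using a n JZ unit meet_join_distrib[of ?a ?n ?J] by simp
    show "(?a \<^bold>\<and> ?n) \<^bold>\<and> (?a \<^bold>\<and> ?J) = \<^bold>0"
      using a n JZ by (simp add: meet_assoc meet_left_comm)
  qed (use a n JZ in auto)
qed

text \<open>Tightness is applied with \<open>X = {x}\<close> and \<open>Y = {}\<close>. The
  right-hand side is then the meet of \<open>\<pi> x\<close> with the unit, or the complement of
  zero in \<open>\<pi> x\<close>.\<close>

lemma tight_imp_cover_to_join:
  fixes \<pi> :: "'e::{semilattice_inf,order_bot} \<Rightarrow> 'b"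
  assumes "tight B \<pi>"
  shows "cover_to_join B \<pi>"
  unfolding cover_to_join_def
proof (intro allI impI, elim conjE)
  fix x :: 'e and Z assume Z: "finite Z" "is_cover Z {z. z \<le> x}"
  have c: "\<pi> x \<in> carrier B"
    using assms by (simp add: tight_def representation_def)
  have Z': "finite {x}" "finite {}" "finite Z" "is_cover Z (relset {x} {})"
    using Z by (auto simp: relset_def)
  from assms have "tight_boolean B \<pi> \<or> tight_no_cover B \<pi>" by (simp add: tight_def)
  then show "gjoins B \<pi> Z = \<pi> x"
  proof
    assume t: "tight_boolean B \<pi>"
    then have "gjoins B \<pi> Z = gmeets B \<pi> {x} \<^bold>\<and> gmeets B (\<lambda>y. gneg B (\<pi> y)) {}"
      using Z' unfolding tight_boolean_def by blast
    moreover obtain u where "is_gunit B u"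
      using t by (auto simp: tight_boolean_def is_boolean_def)
    ultimately show ?thesis using c meet_unit by (simp add: gmeets_def[of _ _ "{}"])
  next
    assume "tight_no_cover B \<pi>"
    then have "gjoins B \<pi> Z =
        rel_compl B (gmeets B \<pi> {x}) (gmeets B \<pi> {x} \<^bold>\<and> gjoins B \<pi> {})"
      using Z' unfolding tight_no_cover_def by blast
    then show ?thesis using c by (simp add: rel_compl_zero)
  qed
qed

lemma cover_to_join_imp_tight_ideal:
  fixes \<pi> :: "'e::{semilattice_inf,order_bot} \<Rightarrow> 'b"
  assumes \<pi>: "representation B \<pi>" and cj: "cover_to_join B \<pi>"
  shows "\<exists>C. gideal B C \<and> range \<pi> \<subseteq> C \<and>
    tight (B\<lparr>carrier := C\<rparr>) \<pi>"
proof (cases "\<exists>W. finite W \<and> is_cover W (UNIV :: 'e set)")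
  case False
  have "tight B \<pi>"
    unfolding tight_def
    using cover_to_join_imp_tight_no_cover[OF \<pi> cj False] \<pi> generalized_boolean_algebra_axioms
    by blast
  moreover have "range \<pi> \<subseteq> carrier B" using \<pi> by (auto simp: representation_def)
  ultimately show ?thesis using gideal_carrier by (intro exI[of _ "carrier B"]) simp
next
  case True
  then obtain W :: "'e set" where W: "finite W" "is_cover W UNIV" by auto
  have c: "\<pi> z \<in> carrier B" for z using \<pi> by (simp add: representation_def)
  let ?w = "gjoins B \<pi> W"
  have w: "?w \<in> carrier B" using W c by auto
  define C where "C = {b \<in> carrier B. b \<preceq> ?w}"
  have ideal: "gideal B C" unfolding C_def using w by (rule gideal_principal)
  have ran: "\<pi> z \<in> C" for z
    using representation_le_gjoins_cover[OF \<pi> cj W] c by (simp add: C_def)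
  \<comment> \<open>Joins of values of \<open>\<pi>\<close> do not change in the ideal, so the
    cover-to-join property carries over.\<close>
  have gj: "gjoins (B\<lparr>carrier := C\<rparr>) \<pi> I = gjoins B \<pi> I" if "finite I" for I
    using gjoins_ideal[OF ideal that] ran by auto
  interpret C: generalized_boolean_algebra "B\<lparr>carrier := C\<rparr>"
    using ideal by (rule gideal_algebra)
  have \<pi>': "representation (B\<lparr>carrier := C\<rparr>) \<pi>" using \<pi> ran by (simp add: representation_def)
  have cj': "cover_to_join (B\<lparr>carrier := C\<rparr>) \<pi>" using cj gj by (simp add: cover_to_join_def)
  have "is_gunit (B\<lparr>carrier := C\<rparr>) ?w"
    using w by (auto simp: is_gunit_def C_def gle_def)
  then have "tight_boolean (B\<lparr>carrier := C\<rparr>) \<pi>"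
    using C.cover_to_join_imp_tight_boolean[OF \<pi>' cj' W] gj W by simp
  then have "tight (B\<lparr>carrier := C\<rparr>) \<pi>"
    using \<pi>' C.generalized_boolean_algebra_axioms by (simp add: tight_def)
  then show ?thesis using ideal ran by blast
qed

end

theorem theorem3p7:
  fixes B :: "('b, 'm) gen_boolean_scheme"
    and \<pi> :: "'e::{semilattice_inf,order_bot} \<Rightarrow> 'b"
  assumes "generalized_boolean_algebra B"
    and "representation B \<pi>"
  shows "(tight B \<pi> \<longrightarrow> cover_to_join B \<pi>) \<and>
    (cover_to_join B \<pi> \<longrightarrow>
      (\<exists>B'. gideal B B' \<and> range \<pi> \<subseteq> B' \<and> tight (B\<lparr>carrier := B'\<rparr>) \<pi>))"
proof -
  interpret generalized_boolean_algebra B by fact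
  show ?thesis
    using tight_imp_cover_to_join[of \<pi>] cover_to_join_imp_tight_ideal[OF assms(2)]
    by (intro conjI impI)
qed

end
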